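(* The Wagner graph $V_8$ is partially DP-nice, and $\alpha_2^{DP}(V_8)\ge 6>|V(V_8)|-\tau(V_8)$.
   Context: All graphs are nonempty, finite and simple. For $m\in\mathbb{N}=\{1,2,\dots\}$ write $[m]=\{1,\dots,m\}$. The Wagner graph $V_8$ has vertex set $\{v_1,\dots,v_8\}$ and edge set $\{v_1v_2,v_2v_3,\dots,v_7v_8,v_8v_1\}\cup\{v_1v_5,v_2v_6,v_3v_7,v_4v_8\}$. The feedback vertex number $\tau(G)$ is the minimum size of a set of vertices of $G$ whose removal yields an acyclic graph. For $S,U\subseteq V(H)$, $E_H(S,U)$ is the set of edges of $H$ with at least one endpoint in $S$ and at least one endpoint in $U$. A cover of a graph $G$ is a pair $\mathcal{H}=(L,H)$ where $H$ is a graph and $L:V(G)\to\mathcal{P}(V(H))$ satisfies: (1) the sets $L(u)$, $u\in V(G)$, partition $V(H)$; (2) $H[L(u)]$ is complete for every $u\in V(G)$; (3) for every $uv\in E(G)$, $E_H(L(u),L(v))$ is a (possibly empty) matching; (4) if $u\neq v$ and $uv\notin E(G)$, then $E_H(L(u),L(v))=\emptyset$. The cover is $m$-fold if $|L(u)|=m$ for all $u\in V(G)$. An $\mathcal{H}$-coloring of $G$ is an independent set of size $|V(G)|$ in $H$. The DP-chromatic number $\chi_{DP}(G)$ is the smallest $m$ such that $G$ has an $\mathcal{H}$-coloring for every $m$-fold cover $\mathcal{H}$ of $G$. For $t\in\mathbb{N}$, the partial DP $t$-chromatic number $\alpha_t^{DP}(G)$ is the minimum of $\alpha(H)$ (the independence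 number of $H$) over all $t$-fold covers $\mathcal{H}=(L,H)$ of $G$. A graph $G$ is partially DP-nice if $\alpha_t^{DP}(G)\ge t|V(G)|/\chi_{DP}(G)$ for all $t\in[\chi_{DP}(G)]$. *)

theory Defs
  imports Complex_Main "HOL-Library.Ramsey" "HOL-Library.Disjoint_Sets"
begin

section \<open>Finite simple graphs\<close>

record 'a graph =
  verts :: "'a set"
  edges :: "'a set set"

definition simple_graph :: "'a graph \<Rightarrow> bool" where
  "simple_graph G \<longleftrightarrow> finite (verts G) \<and> verts G \<noteq> {} \<and> edges G \<subseteq> [verts G]\<^bsup>2\<^esup>"

definition edges_between :: "'a graph \<Rightarrow> 'a set \<Rightarrow> 'a set \<Rightarrow> 'a set set" where
  "edges_between H S U = {e \<in> edges H. e \<inter> S \<noteq> {} \<and> e \<inter> U \<noteq> {}}"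

abbreviation matching :: "'a set set \<Rightarrow> bool" where
  "matching M \<equiv> disjoint M"

definition independent_set :: "'a graph \<Rightarrow> 'a set \<Rightarrow> bool" where
  "independent_set H I \<longleftrightarrow> I \<subseteq> verts H \<and> indep I (edges H)"

definition independence_number :: "'a graph \<Rightarrow> nat" where
  "independence_number H = Max {card I | I. independent_set H I}"

definition delete_vertices :: "'a graph \<Rightarrow> 'a set \<Rightarrow> 'a graph" where
  "delete_vertices G S =
     \<lparr>verts = verts G - S, edges = {e \<in> edges G. e \<subseteq> verts G - S}\<rparr>"

definition is_cycle :: "'a graph \<Rightarrow> 'a list \<Rightarrow> bool" where
  "is_cycle G xs \<longleftrightarrow> 3 \<le> length xs \<and> distinct xs \<and> set xs \<subseteq> verts G \<and>
     (\<forall>i < length xs. {xs ! i, xs ! (Suc i mod length xs)} \<in> edges G)"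

definition acyclic_graph :: "'a graph \<Rightarrow> bool" where
  "acyclic_graph G \<longleftrightarrow> (\<nexists>xs. is_cycle G xs)"

definition feedback_vertex_number :: "'a graph \<Rightarrow> nat" where
  "feedback_vertex_number G =
     Min {card S | S. S \<subseteq> verts G \<and> acyclic_graph (delete_vertices G S)}"


section \<open>Covers and DP-coloring\<close>

text \<open>
  Only the values of \<open>L\<close> on \<open>verts G\<close> matter.
\<close>

definition DP_cover :: "'a graph \<Rightarrow> ('a \<Rightarrow> 'b set) \<Rightarrow> 'b graph \<Rightarrow> bool" where
  "DP_cover G L H \<longleftrightarrow>
     simple_graph H \<and>
     (\<Union>u \<in> verts G. L u) = verts H \<and> disjoint_family_on L (verts G) \<and>
     (\<forall>u \<in> verts G. clique (L u) (edges H)) \<and>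
     (\<forall>u \<in> verts G. \<forall>v \<in> verts G. {u, v} \<in> edges G \<longrightarrow>
        matching (edges_between H (L u) (L v))) \<and>
     (\<forall>u \<in> verts G. \<forall>v \<in> verts G. u \<noteq> v \<and> {u, v} \<notin> edges G \<longrightarrow>
        edges_between H (L u) (L v) = {})"

definition fold_cover :: "nat \<Rightarrow> 'a graph \<Rightarrow> ('a \<Rightarrow> 'b set) \<Rightarrow> 'b graph \<Rightarrow> bool" where
  "fold_cover m G L H \<longleftrightarrow> DP_cover G L H \<and> (\<forall>u \<in> verts G. card (L u) = m)"

definition DP_coloring :: "'a graph \<Rightarrow> 'b graph \<Rightarrow> 'b set \<Rightarrow> bool" where
  "DP_coloring G H I \<longleftrightarrow> independent_set H I \<and> card I = card (verts G)"

text \<open>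
  A definition cannot quantify over all types of cover vertices. Covers are finite,
  so it is enough to let \<open>H\<close> range over the graphs on natural numbers; the lemmas
  \<open>DP_colorable_any_type\<close> and \<open>partial_DP_le_any_type\<close> below confirm that
  covers with other vertex types give nothing new.
\<close>

definition DP_colorable :: "nat \<Rightarrow> 'a graph \<Rightarrow> bool" where
  "DP_colorable m G \<longleftrightarrow>
     (\<forall>L (H :: nat graph). fold_cover m G L H \<longrightarrow> (\<exists>I. DP_coloring G H I))"

text \<open>
  The bound \<open>1 \<le> m\<close> is needed: graphs are nonempty, so there is no \<open>0\<close>-fold cover and
  \<open>DP_colorable 0 G\<close> holds vacuously.
\<close>

definition DP_chromatic_number :: "'a graph \<Rightarrow> nat" where
  "DP_chromatic_number G = (LEAST m. 1 \<le> m \<and> DP_colorable m G)"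

definition partial_DP_chromatic_number :: "nat \<Rightarrow> 'a graph \<Rightarrow> nat" where
  "partial_DP_chromatic_number t G =
     (LEAST k. \<exists>L (H :: nat graph). fold_cover t G L H \<and> k = independence_number H)"

definition partially_DP_nice :: "'a graph \<Rightarrow> bool" where
  "partially_DP_nice G \<longleftrightarrow>
     (\<forall>t \<in> {1..DP_chromatic_number G}.
        real (partial_DP_chromatic_number t G)
          \<ge> real t * real (card (verts G)) / real (DP_chromatic_number G))"


section \<open>The Wagner graph\<close>

definition wagner :: "nat graph" where
  "wagner = \<lparr>verts = {1..8},
     edges = {{i, i + 1} | i. i \<in> {1..7}} \<union> {{8, 1}} \<union> {{i, i + 4} | i. i \<in> {1..4}}\<rparr>"

lemma simple_graph_wagner: "simple_graph wagner"
proof -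
  have "{u, v} \<in> [{1..8::nat}]\<^bsup>2\<^esup>" if "u \<in> {1..8}" "v \<in> {1..8}" "u \<noteq> v" for u v
    using that by (simp add: nsets_def)
  then show ?thesis
    by (auto simp: simple_graph_def wagner_def simp del: One_nat_def)
qed


section \<open>Independence of the type of cover vertices\<close>

definition map_graph :: "('a \<Rightarrow> 'b) \<Rightarrow> 'a graph \<Rightarrow> 'b graph" where
  "map_graph f H = \<lparr>verts = f ` verts H, edges = (`) f ` edges H\<rparr>"

lemma edge_subset:
  assumes "simple_graph H" "e \<in> edges H"
  shows "e \<subseteq> verts H"
  using assms by (auto simp: simple_graph_def nsets_def)

lemma edge_map_graph_iff:
  assumes "simple_graph H" "inj_on f (verts H)" "A \<subseteq> verts H"
  shows "f ` A \<in> edges (map_graph f H) \<longleftrightarrow> A \<in> edges H"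
proof
  assume "f ` A \<in> edges (map_graph f H)"
  then obtain e where e: "e \<in> edges H" "f ` A = f ` e"
    by (auto simp: map_graph_def)
  with assms edge_subset[of H e] have "A = e"
    by (simp add: inj_on_image_eq_iff)
  with e show "A \<in> edges H" by simp
qed (simp add: map_graph_def)

lemma edge_map_graph_pair_iff:
  assumes "simple_graph H" "inj_on f (verts H)" "x \<in> verts H" "y \<in> verts H"
  shows "{f x, f y} \<in> edges (map_graph f H) \<longleftrightarrow> {x, y} \<in> edges H"
  using edge_map_graph_iff[OF assms(1,2), of "{x, y}"] assms(3,4) by simp

lemma simple_graph_map_graph:
  assumes "simple_graph H" "inj_on f (verts H)"
  shows "simple_graph (map_graph f H)"
proof -
  have "f ` e \<in> [f ` verts H]\<^bsup>2\<^esup>" if "e \<in> edges H" for e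
  proof -
    have "e \<subseteq> verts H" "finite e" "card e = 2"
      using that assms(1) by (auto simp: simple_graph_def nsets_def)
    with assms(2) show ?thesis
      by (auto simp: nsets_def card_image inj_on_subset)
  qed
  with assms(1) show ?thesis
    by (auto simp: simple_graph_def map_graph_def)
qed

lemma independent_set_map_graph_iff:
  assumes "simple_graph H" "inj_on f (verts H)" "I \<subseteq> verts H"
  shows "independent_set (map_graph f H) (f ` I) \<longleftrightarrow> independent_set H I"
proof -
  have "indep (f ` I) (edges (map_graph f H)) \<longleftrightarrow> indep I (edges H)"
  proof -
    have "{f x, f y} \<in> edges (map_graph f H) \<longleftrightarrow> {x, y} \<in> edges H"
      and "f x = f y \<longleftrightarrow> x = y" if "x \<in> I" "y \<in> I" for x y
      using that assms edge_map_graph_pair_iff[OF assms(1,2), of x y]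
      by (auto dest: inj_onD)
    then show ?thesis by (simp add: indep_def)
  qed
  with assms(3) show ?thesis
    by (auto simp: independent_set_def map_graph_def)
qed

lemma independent_sets_map_graph:
  assumes "simple_graph H" "inj_on f (verts H)"
  shows "{I. independent_set (map_graph f H) I} = (`) f ` {I. independent_set H I}"
proof (intro equalityI subsetI)
  fix J assume J: "J \<in> {I. independent_set (map_graph f H) I}"
  then have "J \<subseteq> f ` verts H"
    by (simp add: independent_set_def map_graph_def)
  then obtain I where "I \<subseteq> verts H" "J = f ` I"
    by (auto simp: subset_image_iff)
  with J assms show "J \<in> (`) f ` {I. independent_set H I}"
    by (auto simp: independent_set_map_graph_iff)
next
  fix J assume "J \<in> (`) f ` {I. independent_set H I}"
  then obtain I where I: "independent_set H I" "J = f ` I" by blast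
  then have "I \<subseteq> verts H" by (simp add: independent_set_def)
  with I independent_set_map_graph_iff[OF assms] show "J \<in> {I. independent_set (map_graph f H) I}"
    by simp
qed

lemma independence_number_map_graph:
  assumes "simple_graph H" "inj_on f (verts H)"
  shows "independence_number (map_graph f H) = independence_number H"
proof -
  have "{card I | I. independent_set (map_graph f H) I}
      = card ` {I. independent_set (map_graph f H) I}" by auto
  also have "\<dots> = (\<lambda>I. card (f ` I)) ` {I. independent_set H I}"
    by (simp add: independent_sets_map_graph[OF assms] image_image)
  also have "\<dots> = card ` {I. independent_set H I}"
    using assms(2) by (intro image_cong refl)
      (auto simp: independent_set_def intro!: card_image intro: inj_on_subset)
  also have "\<dots> = {card I | I. independent_set H I}" by auto
  finally show ?thesis by (simp add: independence_number_def)
qed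

lemma edges_between_map_graph:
  assumes "simple_graph H" "inj_on f (verts H)" "S \<subseteq> verts H" "U \<subseteq> verts H"
  shows "edges_between (map_graph f H) (f ` S) (f ` U) = (`) f ` edges_between H S U"
proof -
  have "f ` e \<inter> f ` T = {} \<longleftrightarrow> e \<inter> T = {}" if "e \<in> edges H" "T \<subseteq> verts H" for e T
    using edge_subset[OF assms(1) that(1)] that(2) assms(2)
    by (metis image_is_empty inj_on_image_Int)
  with assms(3,4) have "{e \<in> edges H. f ` e \<inter> f ` S \<noteq> {} \<and> f ` e \<inter> f ` U \<noteq> {}}
      = edges_between H S U"
    unfolding edges_between_def by (intro Collect_cong conj_cong refl) simp_all
  then show ?thesis
    unfolding edges_between_def[of "map_graph f H"]
    by (simp add: map_graph_def Compr_image_eq)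
qed

lemma fold_cover_map_graph:
  assumes "fold_cover m G L H" "inj_on f (verts H)"
  shows "fold_cover m G (\<lambda>u. f ` L u) (map_graph f H)"
proof -
  from assms(1) have H: "simple_graph H" and un: "(\<Union>u \<in> verts G. L u) = verts H"
    and dj: "disjoint_family_on L (verts G)"
    and cl: "\<And>u. u \<in> verts G \<Longrightarrow> clique (L u) (edges H)"
    and ma: "\<And>u v. u \<in> verts G \<Longrightarrow> v \<in> verts G \<Longrightarrow> {u, v} \<in> edges G \<Longrightarrow>
               matching (edges_between H (L u) (L v))"
    and em: "\<And>u v. u \<in> verts G \<Longrightarrow> v \<in> verts G \<Longrightarrow> u \<noteq> v \<Longrightarrow> {u, v} \<notin> edges G \<Longrightarrow>
               edges_between H (L u) (L v) = {}"
    and ca: "\<And>u. u \<in> verts G \<Longrightarrow> card (L u) = m"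
    by (simp_all add: fold_cover_def DP_cover_def)
  have sub: "L u \<subseteq> verts H" if "u \<in> verts G" for u
    using un that by blast
  have inj: "inj_on f (L u)" if "u \<in> verts G" for u
    using sub[OF that] assms(2) inj_on_subset by blast
  have eb: "edges_between (map_graph f H) (f ` L u) (f ` L v) = (`) f ` edges_between H (L u) (L v)"
    if "u \<in> verts G" "v \<in> verts G" for u v
    by (rule edges_between_map_graph[OF H assms(2) sub[OF that(1)] sub[OF that(2)]])
  have un': "(\<Union>u \<in> verts G. f ` L u) = verts (map_graph f H)"
    by (simp add: map_graph_def image_UN flip: un)
  have dj': "disjoint_family_on (\<lambda>u. f ` L u) (verts G)"
    unfolding disjoint_family_on_def
  proof (intro ballI impI)
    fix u v assume uv: "u \<in> verts G" "v \<in> verts G" "u \<noteq> v"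
    then have "L u \<inter> L v = {}" using dj by (simp add: disjoint_family_on_def)
    then show "f ` L u \<inter> f ` L v = {}"
      using inj_on_image_Int[OF assms(2) sub[OF uv(1)] sub[OF uv(2)]] by simp
  qed
  have cl': "clique (f ` L u) (edges (map_graph f H))" if "u \<in> verts G" for u
    unfolding clique_def
  proof (intro ballI impI)
    fix x' y' assume "x' \<in> f ` L u" "y' \<in> f ` L u" "x' \<noteq> y'"
    then obtain x y where xy: "x \<in> L u" "y \<in> L u" "x \<noteq> y" "x' = f x" "y' = f y" by auto
    with cl[OF that] have "{x, y} \<in> edges H" by (auto simp: clique_def)
    with xy show "{x', y'} \<in> edges (map_graph f H)"
      using edge_map_graph_pair_iff[OF H assms(2), of x y] sub[OF that] by auto
  qed
  have ma': "matching (edges_between (map_graph f H) (f ` L u) (f ` L v))"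
    if uv: "u \<in> verts G" "v \<in> verts G" "{u, v} \<in> edges G" for u v
    unfolding eb[OF uv(1,2)] disjoint_def
  proof (intro ballI impI)
    fix a b assume "a \<in> (`) f ` edges_between H (L u) (L v)"
      "b \<in> (`) f ` edges_between H (L u) (L v)" "a \<noteq> b"
    then obtain c d where cd: "c \<in> edges_between H (L u) (L v)" "a = f ` c"
      "d \<in> edges_between H (L u) (L v)" "b = f ` d" "c \<noteq> d" by auto
    then have "c \<inter> d = {}" using ma[OF uv] by (simp add: disjoint_def)
    moreover have "c \<subseteq> verts H" "d \<subseteq> verts H"
      using cd edge_subset[OF H] by (auto simp: edges_between_def)
    ultimately show "a \<inter> b = {}"
      using inj_on_image_Int[OF assms(2), of c d] cd by simp
  qed
  show ?thesis
    unfolding fold_cover_def DP_cover_def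
  proof (intro conjI ballI impI)
    fix u v assume "u \<in> verts G" "v \<in> verts G" "u \<noteq> v \<and> {u, v} \<notin> edges G"
    then show "edges_between (map_graph f H) (f ` L u) (f ` L v) = {}"
      using eb em by simp
  next
    fix u assume "u \<in> verts G"
    then show "card (f ` L u) = m"
      using ca card_image[OF inj] by metis
  qed (fact simple_graph_map_graph[OF H assms(2)] un' dj' cl' | rule ma'; assumption)+
qed

lemma ex_nat_inj_verts:
  assumes "simple_graph H"
  obtains f :: "'b \<Rightarrow> nat" where "inj_on f (verts (H :: 'b graph))"
proof -
  have "finite (verts H)" using assms by (simp add: simple_graph_def)
  then show ?thesis using finite_imp_inj_to_nat_seg that by metis
qed

lemma DP_colorable_any_type:
  fixes H :: "'b graph"
  assumes "DP_colorable m G" "fold_cover m G L H"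
  shows "\<exists>I. DP_coloring G H I"
proof -
  have H: "simple_graph H" using assms(2) by (simp add: fold_cover_def DP_cover_def)
  obtain f :: "'b \<Rightarrow> nat" where f: "inj_on f (verts H)"
    using ex_nat_inj_verts[OF H] .
  from assms(1) fold_cover_map_graph[OF assms(2) f]
  obtain J where J: "independent_set (map_graph f H) J" "card J = card (verts G)"
    unfolding DP_colorable_def DP_coloring_def by blast
  then obtain I where I: "independent_set H I" "J = f ` I"
    using independent_sets_map_graph[OF H f] by blast
  then have "card I = card J"
    using f by (metis card_image independent_set_def inj_on_subset)
  with I J show ?thesis by (auto simp: DP_coloring_def)
qed

lemma partial_DP_le_any_type:
  fixes H :: "'b graph"
  assumes "fold_cover t G L H"
  shows "partial_DP_chromatic_number t G \<le> independence_number H"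
proof -
  have H: "simple_graph H" using assms by (simp add: fold_cover_def DP_cover_def)
  obtain f :: "'b \<Rightarrow> nat" where f: "inj_on f (verts H)"
    using ex_nat_inj_verts[OF H] .
  show ?thesis
    unfolding partial_DP_chromatic_number_def
    using fold_cover_map_graph[OF assms f] independence_number_map_graph[OF H f]
    by (intro Least_le) metis
qed

end

theory Submission
  imports Defs
begin

text \<open>
  The DP-chromatic number of \<open>V\<^sub>8\<close> is 3: a 5-cycle prevents 2-colourings, and in a 3-fold cover one
  can colour \<open>v\<^sub>2\<close> and \<open>v\<^sub>8\<close> so that together they exclude at most one colour of \<open>v\<^sub>1\<close> and then
  proceed greedily through \<open>v\<^sub>3, v\<^sub>7, v\<^sub>4, v\<^sub>6, v\<^sub>5, v\<^sub>1\<close>.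
  A 2-fold cover amounts to a signing of the edges. The cycles 12345, 23456 and 1265 form a theta
  graph, so one of them is consistently signed; it is the only cycle of a subgraph induced by six
  vertices, and this subgraph is therefore coloured completely. No two vertices meet all 4-cycles
  and 5-cycles of \<open>V\<^sub>8\<close>, so \<open>\<tau> \<ge> 3\<close>.
\<close>

section \<open>Covers\<close>

lemma indep_number_ge:
  assumes "simple_graph H" "independent_set H I"
  shows "card I \<le> independence_number H"
proof -
  have "finite (verts H)" using assms(1) by (simp add: simple_graph_def)
  then have "finite {I. independent_set H I}"
    by (rule rev_finite_subset[OF finite_Pow_iff[THEN iffD2]]) (auto simp: independent_set_def)
  then have "finite {card I | I. independent_set H I}" by simp
  with assms(2) show ?thesis
    unfolding independence_number_def by (intro Max_ge) auto
qed

lemma cover_nonadjacent: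
  assumes "DP_cover G L H" "u \<in> verts G" "v \<in> verts G" "u \<noteq> v" "{u, v} \<notin> edges G"
  shows "edges_between H (L u) (L v) = {}"
  using assms unfolding DP_cover_def by blast

text \<open>Two edges at \<open>x\<close> between the same two lists cannot be disjoint, so the
  matching condition identifies them. Nonadjacent \<open>u\<close> and \<open>v\<close> have no such
  edges at all, so the claim covers every pair of distinct vertices.\<close>

lemma cover_matched_unique:
  assumes cov: "DP_cover G L H"
    and uv: "u \<in> verts G" "v \<in> verts G" "u \<noteq> v"
    and mem: "x \<in> L u" "y \<in> L v" "y' \<in> L v"
    and ed: "{x, y} \<in> edges H" "{x, y'} \<in> edges H"
  shows "y = y'"
proof -
  have in_eb: "{x, y} \<in> edges_between H (L u) (L v)" "{x, y'} \<in> edges_between H (L u) (L v)"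
    using mem ed by (auto simp: edges_between_def)
  then have "{u, v} \<in> edges G"
    using cover_nonadjacent[OF cov uv] by blast
  then have "matching (edges_between H (L u) (L v))"
    using cov uv by (simp add: DP_cover_def)
  then have "{x, y} = {x, y'}"
    using in_eb by (auto dest: disjointD)
  then show ?thesis by (auto simp: doubleton_eq_iff)
qed

text \<open>\<open>z\<close> is the partner of \<open>x\<close> in \<open>L v\<close> if there is
  one, and arbitrary otherwise, so it may lie outside \<open>L v\<close>.\<close>

lemma cover_forbidden:
  assumes "DP_cover G L H" "u \<in> verts G" "v \<in> verts G" "u \<noteq> v" "x \<in> L u"
  obtains z where "\<And>y. y \<in> L v \<Longrightarrow> y \<noteq> z \<Longrightarrow> {x, y} \<notin> edges H"
  using cover_matched_unique[OF assms] by metis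

text \<open>Otherwise sending each colour of \<open>u\<close> to a partner is injective from
  \<open>L u\<close> into \<open>L v - {z}\<close>, which has only \<open>m - 1\<close>
  elements.\<close>

lemma cover_unmatched:
  assumes cov: "fold_cover m G L H" "m \<ge> 1"
    and uv: "u \<in> verts G" "v \<in> verts G" "u \<noteq> v"
    and z: "z \<in> L v" "\<And>x. x \<in> L u \<Longrightarrow> {x, z} \<notin> edges H"
  shows "\<exists>x \<in> L u. \<forall>y \<in> L v. {x, y} \<notin> edges H"
proof (rule ccontr)
  assume "\<not> ?thesis"
  then obtain p where p: "\<And>x. x \<in> L u \<Longrightarrow> p x \<in> L v" "\<And>x. x \<in> L u \<Longrightarrow> {x, p x} \<in> edges H"
    by metis
  have dp: "DP_cover G L H" and card: "card (L u) = m" "card (L v) = m"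
    using cov uv by (auto simp: fold_cover_def)
  have "inj_on p (L u)"
  proof (rule inj_onI)
    fix x x' assume "x \<in> L u" "x' \<in> L u" "p x = p x'"
    then show "x = x'"
      using cover_matched_unique[OF dp uv(2,1) uv(3)[symmetric], of "p x" x x'] p
      by (metis insert_commute)
  qed
  moreover have fin: "finite (L v)" using card cov(2) by (intro card_ge_0_finite) simp
  moreover have "p ` L u \<subseteq> L v - {z}" using p z by auto
  ultimately have "card (L u) \<le> card (L v - {z})"
    by (intro card_inj_on_le) auto
  then show False
    using card cov(2) z(1) fin by simp
qed

text \<open>
  The step behind Brooks' theorem: if some colour of \<open>v\<close> is unmatched in \<open>L u\<close> or in \<open>L w\<close>,
  then, the lists having equal size, so is some colour on the other side; otherwise its two
  partners exclude the same colour.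
\<close>

lemma cover_common_forbidden:
  assumes cov: "fold_cover m G L H" "m \<ge> 1"
    and vs: "u \<in> verts G" "v \<in> verts G" "w \<in> verts G" "u \<noteq> v" "w \<noteq> v"
  obtains x x' z where "x \<in> L u" "x' \<in> L w"
    "\<And>y. y \<in> L v \<Longrightarrow> y \<noteq> z \<Longrightarrow> {x, y} \<notin> edges H"
    "\<And>y. y \<in> L v \<Longrightarrow> y \<noteq> z \<Longrightarrow> {x', y} \<notin> edges H"
proof -
  have dp: "DP_cover G L H" and ne: "L u \<noteq> {}" "L v \<noteq> {}" "L w \<noteq> {}"
    using cov vs by (auto simp: fold_cover_def)
  then obtain c a b where c: "c \<in> L v" and a: "a \<in> L u" and b: "b \<in> L w" by blast
  consider (u) "\<forall>x \<in> L u. {x, c} \<notin> edges H" | (w) "\<forall>x \<in> L w. {x, c} \<notin> edges H"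
    | (both) x x' where "x \<in> L u" "{x, c} \<in> edges H" "x' \<in> L w" "{x', c} \<in> edges H"
    by blast
  then show thesis
  proof cases
    case u
    then obtain x where x: "x \<in> L u" "\<forall>y \<in> L v. {x, y} \<notin> edges H"
      using cover_unmatched[OF cov vs(1,2,4) c] by blast
    obtain z where "\<And>y. y \<in> L v \<Longrightarrow> y \<noteq> z \<Longrightarrow> {b, y} \<notin> edges H"
      using cover_forbidden[OF dp vs(3,2,5) b] by blast
    with x b show thesis using that by blast
  next
    case w
    then obtain x where x: "x \<in> L w" "\<forall>y \<in> L v. {x, y} \<notin> edges H"
      using cover_unmatched[OF cov vs(3,2,5) c] by blast
    obtain z where "\<And>y. y \<in> L v \<Longrightarrow> y \<noteq> z \<Longrightarrow> {a, y} \<notin> edges H"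
      using cover_forbidden[OF dp vs(1,2,4) a] by blast
    with x a show thesis using that by blast
  next
    case both
    then show thesis
      using that[of x x' c] c cover_matched_unique[OF dp vs(1,2,4)]
        cover_matched_unique[OF dp vs(3,2,5)] by metis
  qed
qed

text \<open>Disjoint lists make \<open>g\<close> injective on \<open>U\<close>, and nonadjacent
  vertices have no cover edges between their lists. Only edges of \<open>G\<close> remain to be
  tested, each in the orientation listed in \<open>A\<close>.\<close>

lemma independent_set_transversal:
  assumes cov: "DP_cover G L H"
    and ed: "edges G = (\<lambda>(u, v). {u, v}) ` A"
    and U: "U \<subseteq> verts G" "\<And>u. u \<in> U \<Longrightarrow> g u \<in> L u"
    and nonadj: "\<And>u v. (u, v) \<in> A \<Longrightarrow> u \<in> U \<Longrightarrow> v \<in> U \<Longrightarrow> {g u, g v} \<notin> edges H"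
  shows "independent_set H (g ` U)" "card (g ` U) = card U"
proof -
  have "inj_on g U"
    using cov U unfolding DP_cover_def disjoint_family_on_def inj_on_def
    by (metis disjoint_iff subsetD)
  then show "card (g ` U) = card U" by (rule card_image)
  have "{g u, g v} \<notin> edges H" if uv: "u \<in> U" "v \<in> U" "u \<noteq> v" for u v
  proof (cases "{u, v} \<in> edges G")
    case True
    then have "(u, v) \<in> A \<or> (v, u) \<in> A"
      unfolding ed by (auto simp: doubleton_eq_iff)
    then show ?thesis using nonadj uv by (metis insert_commute)
  next
    case False
    then have "edges_between H (L u) (L v) = {}"
      using cover_nonadjacent[OF cov] U(1) uv by blast
    then show ?thesis using U(2) uv by (auto simp: edges_between_def)
  qed
  moreover have "g ` U \<subseteq> verts H" using cov U by (auto simp: DP_cover_def)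
  ultimately show "independent_set H (g ` U)"
    by (auto simp: independent_set_def indep_def)
qed


section \<open>The Cartesian product with a complete graph\<close>

text \<open>Viewed as a cover of a simple graph \<open>G\<close>, it matches equal colours, so its
  full-size independent sets are the proper colourings of \<open>G\<close> with \<open>m\<close>
  colours.\<close>

definition box_complete :: "nat \<Rightarrow> 'a graph \<Rightarrow> ('a \<times> nat) graph" where
  "box_complete m G = \<lparr>verts = verts G \<times> {..<m},
     edges = {{(u, i), (u, j)} | u i j. u \<in> verts G \<and> i < m \<and> j < m \<and> i \<noteq> j}
       \<union> {{(u, i), (v, i)} | u v i. {u, v} \<in> edges G \<and> i < m}\<rparr>"

lemma simple_graph_edgeD:
  assumes "simple_graph G" "{u, v} \<in> edges G"
  shows "u \<in> verts G" "v \<in> verts G" "u \<noteq> v"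
  using assms by (auto simp: simple_graph_def nsets_def)

lemma fold_cover_box_complete:
  assumes G: "simple_graph G" and m: "m \<ge> 1"
  shows "fold_cover m G (\<lambda>u. {u} \<times> {..<m}) (box_complete m G)"
proof -
  let ?H = "box_complete m G" and ?L = "\<lambda>u. {u} \<times> {..<m}"
  have "simple_graph ?H"
    unfolding simple_graph_def
  proof (intro conjI subsetI)
    show "finite (verts ?H)" "verts ?H \<noteq> {}"
      using G m by (auto simp: simple_graph_def box_complete_def lessThan_empty_iff)
    fix e assume "e \<in> edges ?H"
    then show "e \<in> [verts ?H]\<^bsup>2\<^esup>"
      using simple_graph_edgeD[OF G] by (auto simp: box_complete_def nsets_def card_insert_if)
  qed
  moreover have eb: "edges_between ?H (?L u) (?L v) \<subseteq> {{(u, i), (v, i)} | i. {u, v} \<in> edges G \<and> i < m}"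
    if "u \<noteq> v" for u v
    using that by (auto simp: edges_between_def box_complete_def insert_commute)
  then have "edges_between ?H (?L u) (?L v) = {}" if "u \<noteq> v" "{u, v} \<notin> edges G" for u v
    using that by blast
  moreover have "matching (edges_between ?H (?L u) (?L v))" if "{u, v} \<in> edges G" for u v
  proof -
    have "u \<noteq> v" using simple_graph_edgeD[OF G that] by simp
    then have "matching {{(u, i), (v, i)} | i. {u, v} \<in> edges G \<and> i < m}"
      by (auto simp: disjoint_def)
    then show ?thesis
      using eb[OF \<open>u \<noteq> v\<close>] by (rule pairwise_subset)
  qed
  moreover have "clique (?L u) (edges ?H)" if "u \<in> verts G" for u
    using that by (auto simp: clique_def box_complete_def)
  moreover have "(\<Union>u \<in> verts G. ?L u) = verts ?H"
    by (auto simp: box_complete_def)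
  moreover have "disjoint_family_on ?L (verts G)"
    by (auto simp: disjoint_family_on_def)
  ultimately show ?thesis
    by (simp add: fold_cover_def DP_cover_def card_cartesian_product)
qed

text \<open>Each fibre is a clique, so an independent set of full size meets it exactly once and is
  the graph of a function \<open>f\<close>. Ordinary colouring thus bounds the DP-chromatic number
  from below.\<close>

lemma DP_colorable_imp_coloring:
  assumes G: "simple_graph G" and m: "m \<ge> 1" "DP_colorable m G"
  obtains f where "\<And>u. u \<in> verts G \<Longrightarrow> f u < m"
    "\<And>u v. {u, v} \<in> edges G \<Longrightarrow> f u \<noteq> f v"
proof -
  obtain I where I: "independent_set (box_complete m G) I" "card I = card (verts G)"
    using DP_colorable_any_type[OF m(2) fold_cover_box_complete[OF G m(1)]]
    by (auto simp: DP_coloring_def)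
  have sub: "I \<subseteq> verts G \<times> {..<m}"
    and ind: "\<And>x y. x \<in> I \<Longrightarrow> y \<in> I \<Longrightarrow> x \<noteq> y \<Longrightarrow> {x, y} \<notin> edges (box_complete m G)"
    using I by (auto simp: independent_set_def indep_def box_complete_def)
  have "inj_on fst I"
  proof (rule inj_onI)
    fix x y assume xy: "x \<in> I" "y \<in> I" "fst x = fst y"
    then have "snd x \<noteq> snd y \<Longrightarrow> {x, y} \<in> edges (box_complete m G)"
      using sub by (cases x; cases y) (auto simp: box_complete_def)
    then show "x = y" using xy ind by (auto simp: prod_eq_iff)
  qed
  then have "fst ` I = verts G"
    using sub I(2) G by (intro card_subset_eq) (auto simp: simple_graph_def card_image)
  then have "\<forall>u \<in> verts G. \<exists>i. (u, i) \<in> I" by force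
  then obtain f where f: "\<And>u. u \<in> verts G \<Longrightarrow> (u, f u) \<in> I" by metis
  show thesis
  proof (rule that)
    show lt: "f u < m" if "u \<in> verts G" for u
      using f[OF that] sub by auto
    show "f u \<noteq> f v" if uv: "{u, v} \<in> edges G" for u v
    proof
      note vs = simple_graph_edgeD[OF G uv]
      assume "f u = f v"
      then have "{(u, f u), (v, f v)} \<in> edges (box_complete m G)"
        using uv lt[OF vs(1)] by (auto simp: box_complete_def)
      then show False using ind[OF f[OF vs(1)] f[OF vs(2)]] vs(3) by simp
    qed
  qed
qed

text \<open>
  The cover by \<open>box_complete\<close> ensures that the minimum defining the partial DP chromatic number
  is taken over a nonempty set.
\<close>

lemma partial_DP_geI:
  assumes G: "simple_graph G" and t: "t \<ge> 1"
    and bound: "\<And>L (H :: nat graph). fold_cover t G L H \<Longrightarrow> \<exists>I. independent_set H I \<and> k \<le> card I"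
  shows "k \<le> partial_DP_chromatic_number t G"
proof -
  \<comment> \<open>The definition ranges over cover graphs on \<open>nat\<close>, so the product is
    transported along an injection.\<close>
  obtain f :: "'a \<times> nat \<Rightarrow> nat" where f: "inj_on f (verts (box_complete t G))"
    using ex_nat_inj_verts fold_cover_box_complete[OF G t]
    by (metis DP_cover_def fold_cover_def)
  have "\<exists>n L (H :: nat graph). fold_cover t G L H \<and> n = independence_number H"
    using fold_cover_map_graph[OF fold_cover_box_complete[OF G t] f] by blast
  then have "\<exists>L (H :: nat graph). fold_cover t G L H
      \<and> partial_DP_chromatic_number t G = independence_number H"
    unfolding partial_DP_chromatic_number_def by (rule LeastI_ex)
  then obtain L and H :: "nat graph" where H: "fold_cover t G L H"
    "partial_DP_chromatic_number t G = independence_number H" by blast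
  moreover from H(1) have "simple_graph H" by (simp add: fold_cover_def DP_cover_def)
  ultimately show ?thesis
    using bound[OF H(1)] indep_number_ge by fastforce
qed


section \<open>The Wagner graph\<close>

lemma verts_wagner: "verts wagner = {1, 2, 3, 4, 5, 6, 7, 8}"
  by (auto simp: wagner_def)

text \<open>One orientation per edge. It makes edge checks finite evaluations and fixes the
  direction in which the signs of a 2-fold cover are read.\<close>

definition wagner_arcs :: "(nat \<times> nat) set" where
  "wagner_arcs = {(1, 2), (2, 3), (3, 4), (4, 5), (5, 6), (6, 7), (7, 8), (8, 1),
     (1, 5), (2, 6), (3, 7), (4, 8)}"

lemma edges_wagner: "edges wagner = (\<lambda>(u, v). {u, v}) ` wagner_arcs"
proof -
  have "{1..7::nat} = {1, 2, 3, 4, 5, 6, 7}" "{1..4::nat} = {1, 2, 3, 4}" by auto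
  then have "{{i, i + 1} | i. i \<in> {1..7::nat}} = (\<lambda>i. {i, i + 1}) ` {1, 2, 3, 4, 5, 6, 7}"
    "{{i, i + 4} | i. i \<in> {1..4::nat}} = (\<lambda>i. {i, i + 4}) ` {1, 2, 3, 4}"
    by blast+
  then show ?thesis
    unfolding wagner_def wagner_arcs_def
    by (simp only: graph.select_convs image_insert image_empty Un_insert_left Un_empty_left prod.case) (simp del: One_nat_def)
qed

lemma card_wagner: "card (verts wagner) = 8"
  by (simp add: wagner_def)

lemma wagner_edge: "(u, v) \<in> wagner_arcs \<Longrightarrow> {u, v} \<in> edges wagner"
  by (auto simp: edges_wagner)

section \<open>Independent sets in 1-fold and 3-fold covers\<close>

text \<open>The set \<open>{1, 3, 6}\<close> is independent in the Wagner graph, so its three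
  colours are independent in every 1-fold cover.\<close>

lemma one_fold_wagner:
  assumes "fold_cover 1 wagner L H"
  shows "\<exists>I. independent_set H I \<and> 3 \<le> card I"
proof -
  have "\<forall>u \<in> verts wagner. \<exists>x. x \<in> L u"
    using assms by (auto simp: fold_cover_def card_1_singleton_iff)
  then obtain g where "\<And>u. u \<in> verts wagner \<Longrightarrow> g u \<in> L u" by metis
  moreover have "DP_cover wagner L H" using assms by (simp add: fold_cover_def)
  moreover have "(u, v) \<notin> wagner_arcs" if "u \<in> {1, 3, 6}" "v \<in> {1, 3, 6}" for u v
    using that by (auto simp: wagner_arcs_def)
  moreover have "{1, 3, 6} \<subseteq> verts wagner" by (simp add: verts_wagner)
  ultimately have "independent_set H (g ` {1, 3, 6})" "card (g ` {1, 3, 6}) = card {1::nat, 3, 6}"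
    using independent_set_transversal[OF _ edges_wagner, of L H "{1, 3, 6}" g] by blast+
  then show ?thesis by (intro exI[of _ "g ` {1, 3, 6}"]) simp
qed

lemma three_fold_wagner:
  assumes cov: "fold_cover 3 wagner L H"
  shows "\<exists>I. independent_set H I \<and> card I = 8"
proof -
  have dp: "DP_cover wagner L H" using cov by (simp add: fold_cover_def)
  have forb: "\<exists>z. \<forall>y \<in> L v. y \<noteq> z \<longrightarrow> {x, y} \<notin> edges H"
    if "x \<in> L u" "u \<noteq> v" "u \<in> {1, 2, 3, 4, 5, 6, 7, 8}" "v \<in> {1, 2, 3, 4, 5, 6, 7, 8}" for x u v
    using cover_forbidden[OF dp _ _ that(2,1)] that(3,4) unfolding verts_wagner by metis
  have pick: "\<exists>y \<in> L v. y \<noteq> z \<and> y \<noteq> z'" if "v \<in> {1, 2, 3, 4, 5, 6, 7, 8}" for v z z'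
  proof (rule ccontr)
    assume "\<not> ?thesis"
    then have "card (L v) \<le> card {z, z'}" by (intro card_mono) auto
    also have "\<dots> \<le> 2" by (simp add: card_insert_if)
    finally have "card (L v) \<le> 2" .
    moreover have "card (L v) = 3" using cov that by (simp only: fold_cover_def verts_wagner)
    ultimately show False by simp
  qed
  \<comment> \<open>Greedy step: two coloured neighbours exclude at most two of the three colours.
    Passing one neighbour twice handles a vertex with a single coloured neighbour.\<close>
  have ext: "\<exists>y \<in> L v. {x, y} \<notin> edges H \<and> {x', y} \<notin> edges H"
    if "x \<in> L u" "u \<noteq> v" "x' \<in> L w" "w \<noteq> v" "u \<in> {1, 2, 3, 4, 5, 6, 7, 8}"
      "v \<in> {1, 2, 3, 4, 5, 6, 7, 8}" "w \<in> {1, 2, 3, 4, 5, 6, 7, 8}" for x x' u v w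
    using forb[OF that(1,2,5,6)] forb[OF that(3,4,7,6)] pick[OF that(6)] by metis
  obtain x2 x8 z where x2: "x2 \<in> L 2" and x8: "x8 \<in> L 8"
    and z2: "\<And>y. y \<in> L 1 \<Longrightarrow> y \<noteq> z \<Longrightarrow> {x2, y} \<notin> edges H"
    and z8: "\<And>y. y \<in> L 1 \<Longrightarrow> y \<noteq> z \<Longrightarrow> {x8, y} \<notin> edges H"
    by (rule cover_common_forbidden[OF cov, of 2 1 8]) (auto simp: verts_wagner)
  obtain x3 where x3: "x3 \<in> L 3" "{x2, x3} \<notin> edges H"
    using ext[OF x2 _ x2, of 3] by auto
  obtain x7 where x7: "x7 \<in> L 7" "{x3, x7} \<notin> edges H" "{x8, x7} \<notin> edges H"
    using ext[OF x3(1) _ x8, of 7] by auto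
  obtain x4 where x4: "x4 \<in> L 4" "{x3, x4} \<notin> edges H" "{x8, x4} \<notin> edges H"
    using ext[OF x3(1) _ x8, of 4] by auto
  obtain x6 where x6: "x6 \<in> L 6" "{x2, x6} \<notin> edges H" "{x7, x6} \<notin> edges H"
    using ext[OF x2 _ x7(1), of 6] by auto
  obtain x5 where x5: "x5 \<in> L 5" "{x4, x5} \<notin> edges H" "{x6, x5} \<notin> edges H"
    using ext[OF x4(1) _ x6(1), of 5] by auto
  obtain z' where z': "\<And>y. y \<in> L 1 \<Longrightarrow> y \<noteq> z' \<Longrightarrow> {x5, y} \<notin> edges H"
    using forb[OF x5(1), of 1] by auto
  \<comment> \<open>Vertex 1 has three coloured neighbours, but 2 and 8 share the excluded colour
    \<open>z\<close>, so only two colours must be avoided.\<close>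
  obtain x1 where x1: "x1 \<in> L 1" "x1 \<noteq> z" "x1 \<noteq> z'" using pick[of 1 z z'] by auto
  define g :: "nat \<Rightarrow> 'a" where "g = undefined(1 := x1, 2 := x2, 3 := x3, 4 := x4, 5 := x5, 6 := x6, 7 := x7, 8 := x8)"
  have "{x1, x2} \<notin> edges H" "{x8, x1} \<notin> edges H" "{x1, x5} \<notin> edges H"
    using z2[OF x1(1,2)] z8[OF x1(1,2)] z'[OF x1(1,3)] by (simp_all add: insert_commute)
  moreover have "{x5, x6} \<notin> edges H" "{x6, x7} \<notin> edges H" "{x7, x8} \<notin> edges H" "{x4, x8} \<notin> edges H"
    using x5(3) x6(3) x7(3) x4(3) by (simp_all add: insert_commute)
  ultimately have "\<forall>(u, v) \<in> wagner_arcs. {g u, g v} \<notin> edges H"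
    using x3(2) x4(2) x5(2) x6(2) x7(2) by (simp add: wagner_arcs_def g_def)
  then have nonadj: "{g u, g v} \<notin> edges H" if "(u, v) \<in> wagner_arcs" for u v
    using that by blast
  have mem: "g u \<in> L u" if "u \<in> verts wagner" for u
    using that x1(1) x2 x3(1) x4(1) x5(1) x6(1) x7(1) x8
    unfolding verts_wagner by (elim insertE emptyE) (simp_all add: g_def)
  have "independent_set H (g ` verts wagner)" "card (g ` verts wagner) = card (verts wagner)"
    using independent_set_transversal[OF dp edges_wagner subset_refl mem nonadj] by auto
  then show ?thesis by (auto simp: card_wagner)
qed

lemma DP_chromatic_number_wagner: "DP_chromatic_number wagner = 3"
  unfolding DP_chromatic_number_def
proof (rule Least_equality)
  show "1 \<le> (3::nat) \<and> DP_colorable 3 wagner"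
    by (auto simp: DP_colorable_def DP_coloring_def card_wagner intro: three_fold_wagner)
next
  fix m :: nat assume m: "1 \<le> m \<and> DP_colorable m wagner"
  then obtain f where f: "\<And>u. u \<in> verts wagner \<Longrightarrow> f u < m"
    "\<And>u v. {u, v} \<in> edges wagner \<Longrightarrow> f u \<noteq> f v"
    using DP_colorable_imp_coloring[OF simple_graph_wagner] by blast
  \<comment> \<open>The odd cycle 12345 rules out two colours.\<close>
  have "f 1 \<noteq> f 2" "f 2 \<noteq> f 3" "f 3 \<noteq> f 4" "f 4 \<noteq> f 5" "f 1 \<noteq> f 5"
    by (rule f(2), rule wagner_edge, simp add: wagner_arcs_def)+
  moreover have "f 1 < m" "f 2 < m" "f 3 < m" "f 4 < m" "f 5 < m"
    by (simp_all add: f(1) verts_wagner)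
  ultimately show "3 \<le> m" by linarith
qed

section \<open>Two-fold covers as signings\<close>

text \<open>
  A partial matching between two lists of size two misses one of the two perfect matchings.
\<close>

lemma two_fold_signature:
  assumes "fold_cover 2 G L H"
  obtains c s where "\<And>u a. u \<in> verts G \<Longrightarrow> c u a \<in> L u"
    "\<And>u v a. u \<in> verts G \<Longrightarrow> v \<in> verts G \<Longrightarrow> u \<noteq> v \<Longrightarrow> {c u a, c v (a \<noteq> s u v)} \<notin> edges H"
proof -
  have dp: "DP_cover G L H" using assms by (simp add: fold_cover_def)
  have "\<forall>u \<in> verts G. \<exists>k. (\<forall>a::bool. k a \<in> L u) \<and> k False \<noteq> k True"
  proof
    fix u assume "u \<in> verts G"
    then obtain x y where "L u = {x, y}" "x \<noteq> y"
      using assms by (auto simp: fold_cover_def card_2_iff)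
    then show "\<exists>k. (\<forall>a::bool. k a \<in> L u) \<and> k False \<noteq> k True"
      by (intro exI[of _ "\<lambda>a. if a then x else y"]) auto
  qed
  then obtain c where c: "\<And>u a. u \<in> verts G \<Longrightarrow> c u a \<in> L u"
    "\<And>u. u \<in> verts G \<Longrightarrow> c u False \<noteq> c u True" by metis
  \<comment> \<open>On booleans \<open>\<noteq>\<close> is exclusive or, and \<open>s\<close>
    selects a perfect matching free of cover edges. If both choices failed, each perfect matching
    would contain a cover edge; two such edges share an endpoint, on the side of \<open>u\<close> or
    of \<open>v\<close>, against uniqueness of partners.\<close>
  have "\<exists>s. \<forall>a. {c u a, c v (a \<noteq> s)} \<notin> edges H"
    if uv: "u \<in> verts G" "v \<in> verts G" "u \<noteq> v" for u v
  proof (rule ccontr)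
    assume "\<not> ?thesis"
    then have "\<exists>a. {c u a, c v (a \<noteq> False)} \<in> edges H" "\<exists>b. {c u b, c v (b \<noteq> True)} \<in> edges H"
      by blast+
    then obtain a b where ab: "{c u a, c v a} \<in> edges H" "{c u b, c v (\<not> b)} \<in> edges H" by auto
    show False
    proof (cases "a = b")
      case True
      then have "c v a = c v (\<not> a)"
        using cover_matched_unique[OF dp uv, of "c u a" "c v a" "c v (\<not> a)"] c(1) uv ab by simp
      then show False using c(2)[OF uv(2)] by (cases a) auto
    next
      case False
      then have "c u a = c u (\<not> a)"
        using cover_matched_unique[OF dp uv(2,1) uv(3)[symmetric], of "c v a" "c u a" "c u b"]
          c(1) uv ab by (auto simp: insert_commute)
      then show False using c(2)[OF uv(1)] by (cases a) auto
    qed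
  qed
  then obtain s where "\<And>u v a. u \<in> verts G \<Longrightarrow> v \<in> verts G \<Longrightarrow> u \<noteq> v \<Longrightarrow>
      {c u a, c v (a \<noteq> s u v)} \<notin> edges H" by metis
  with c(1) show thesis by (rule that)
qed

lemma two_fold_wagner:
  assumes cov: "fold_cover 2 wagner L H"
  shows "\<exists>I. independent_set H I \<and> 6 \<le> card I"
proof -
  have dp: "DP_cover wagner L H" using cov by (simp add: fold_cover_def)
  obtain c s where c: "\<And>u a. u \<in> verts wagner \<Longrightarrow> c u a \<in> L u"
    and s: "\<And>u v a. u \<in> verts wagner \<Longrightarrow> v \<in> verts wagner \<Longrightarrow> u \<noteq> v \<Longrightarrow>
      {c u a, c v (a \<noteq> s u v)} \<notin> edges H"
    using two_fold_signature[OF cov] by blast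
  have suff: ?thesis
    if U: "U \<subseteq> verts wagner" "card U = 6"
      and f: "\<forall>(u, v) \<in> wagner_arcs. u \<in> U \<longrightarrow> v \<in> U \<longrightarrow> f v = (f u \<noteq> s u v)"
    for U and f :: "nat \<Rightarrow> bool"
  proof -
    have "{c u (f u), c v (f v)} \<notin> edges H" if uv: "(u, v) \<in> wagner_arcs" "u \<in> U" "v \<in> U" for u v
    proof -
      have "u \<noteq> v" using uv(1) by (auto simp: wagner_arcs_def)
      then show ?thesis
        using s[of u v "f u"] bspec[OF f uv(1)] U(1) uv(2,3) by auto
    qed
    moreover have "c u (f u) \<in> L u" if "u \<in> U" for u using c U(1) that by blast
    ultimately have "independent_set H ((\<lambda>u. c u (f u)) ` U)" "card ((\<lambda>u. c u (f u)) ` U) = 6"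
      using independent_set_transversal[OF dp edges_wagner U(1), of "\<lambda>u. c u (f u)"] U(2) by auto
    then show ?thesis by (metis order_refl)
  qed
  \<comment> \<open>Values forced along the path 1, ..., 6 when vertex 1 gets \<open>False\<close>;
    \<open>g6\<close> is the value forced at 6 through 1, 5, 6 instead.\<close>
  define f2 f3 f4 f5 f6 where f_defs: "f2 = s 1 2" "f3 = (f2 \<noteq> s 2 3)" "f4 = (f3 \<noteq> s 3 4)"
    "f5 = (f4 \<noteq> s 4 5)" "f6 = (f5 \<noteq> s 5 6)"
  define g6 where "g6 = (s 1 5 \<noteq> s 5 6)"
  \<comment> \<open>The cases say that 12345, 23456 or 1265 is consistently signed. If the first
    fails, then \<open>f6\<close> and \<open>g6\<close> differ, so one of them equals the value that
    2 forces at 6.\<close>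
  consider (C1) "f5 = s 1 5" | (C2) "f6 = (f2 \<noteq> s 2 6)" | (Q) "g6 = (f2 \<noteq> s 2 6)"
    unfolding f_defs(5) g6_def by blast
  then show ?thesis
  proof cases
    case C1
    \<comment> \<open>The default \<open>False\<close> is the value of vertex 1. Vertex 7 hangs at 3
      as a leaf of the induced subgraph, so its value can be chosen freely to fit.\<close>
    let ?f = "(\<lambda>_. False)(2 := f2, 3 := f3, 4 := f4, 5 := f5, 7 := (f3 \<noteq> s 3 7))"
    show ?thesis
      by (rule suff[of "{1, 2, 3, 4, 5, 7}" ?f])
        (use C1 in \<open>simp_all add: verts_wagner wagner_arcs_def f_defs\<close>)
  next
    case C2
    let ?f = "(\<lambda>_. False)(2 := f2, 3 := f3, 4 := f4, 5 := f5, 6 := f6, 8 := (f4 \<noteq> s 4 8))"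
    show ?thesis
      by (rule suff[of "{2, 3, 4, 5, 6, 8}" ?f])
        (use C2 in \<open>simp_all add: verts_wagner wagner_arcs_def f_defs\<close>)
  next
    case Q
    \<comment> \<open>The leaves are 4 at 5 and 7 at 6; the value of 4 is obtained backwards along
      the arc from 4 to 5.\<close>
    let ?f = "(\<lambda>_. False)(2 := f2, 4 := (s 1 5 \<noteq> s 4 5), 5 := s 1 5, 6 := g6, 7 := (g6 \<noteq> s 6 7))"
    show ?thesis
      by (rule suff[of "{1, 2, 4, 5, 6, 7}" ?f])
        (use Q in \<open>simp_all add: verts_wagner wagner_arcs_def f_defs g6_def\<close>, blast)
  qed
qed

section \<open>Short cycles and the feedback vertex number\<close>

text \<open>\<open>rotate1\<close> pairs each vertex with its cyclic successor, so for a concrete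
  list the edge condition is decided by evaluation.\<close>

lemma is_cycleI:
  assumes "edges G = (\<lambda>(u, v). {u, v}) ` A"
    and "3 \<le> length xs" "distinct xs" "set xs \<subseteq> verts G"
    and "list_all2 (\<lambda>u v. (u, v) \<in> A \<or> (v, u) \<in> A) xs (rotate1 xs)"
  shows "is_cycle G xs"
  unfolding is_cycle_def
proof (intro conjI allI impI)
  fix i assume i: "i < length xs"
  with assms(5) have "(xs ! i, xs ! (Suc i mod length xs)) \<in> A \<or> (xs ! (Suc i mod length xs), xs ! i) \<in> A"
    by (auto simp: nth_rotate1 dest: list_all2_nthD)
  then show "{xs ! i, xs ! (Suc i mod length xs)} \<in> edges G"
    unfolding assms(1) by (auto simp: insert_commute intro: rev_image_eqI)
qed (fact assms)+

text \<open>The 4-cycles use two consecutive spokes; the 5-cycles close four consecutive rim edges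
  by a spoke.\<close>

lemma wagner_cycles:
  assumes "xs \<in> {[1, 2, 6, 5], [2, 3, 7, 6], [3, 4, 8, 7], [4, 5, 1, 8], [1, 2, 3, 4, 5],
    [2, 3, 4, 5, 6], [3, 4, 5, 6, 7], [4, 5, 6, 7, 8], [5, 6, 7, 8, 1], [6, 7, 8, 1, 2],
    [7, 8, 1, 2, 3], [8, 1, 2, 3, 4]}"
  shows "is_cycle wagner xs"
proof (rule is_cycleI[OF edges_wagner])
  show "3 \<le> length xs" "distinct xs"
    using assms by (elim insertE emptyE; simp)+
  show "set xs \<subseteq> verts wagner"
    using assms by (elim insertE emptyE; simp add: verts_wagner)
  show "list_all2 (\<lambda>u v. (u, v) \<in> wagner_arcs \<or> (v, u) \<in> wagner_arcs) xs (rotate1 xs)"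
    using assms by (elim insertE emptyE; simp add: wagner_arcs_def)
qed

lemma is_cycle_delete_vertices:
  assumes "is_cycle G xs" "set xs \<inter> S = {}"
  shows "is_cycle (delete_vertices G S) xs"
proof -
  have "xs ! i \<notin> S \<and> xs ! i \<in> verts G" if "i < length xs" for i
    using assms nth_mem[OF that] by (auto simp: is_cycle_def)
  moreover have "Suc i mod length xs < length xs" if "i < length xs" for i
    using that by (intro mod_less_divisor) auto
  ultimately show ?thesis
    using assms by (auto simp: is_cycle_def delete_vertices_def)
qed

lemma feedback_vertex_number_wagner: "feedback_vertex_number wagner \<ge> 3"
proof -
  let ?F = "{card S | S. S \<subseteq> verts wagner \<and> acyclic_graph (delete_vertices wagner S)}"
  have "acyclic_graph (delete_vertices wagner (verts wagner))"
    by (auto simp: acyclic_graph_def is_cycle_def delete_vertices_def)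
  then have ne: "?F \<noteq> {}" by blast
  have fin: "finite ?F" by (simp add: verts_wagner)
  have "3 \<le> card S" if S: "S \<subseteq> verts wagner" "acyclic_graph (delete_vertices wagner S)" for S
  proof (rule ccontr)
    assume "\<not> 3 \<le> card S"
    have hit: "set xs \<inter> S \<noteq> {}" if "is_cycle wagner xs" for xs
      using is_cycle_delete_vertices[OF that] S(2) by (auto simp: acyclic_graph_def)
    have hits: "set [1, 2, 6, 5] \<inter> S \<noteq> {}" "set [2, 3, 7, 6] \<inter> S \<noteq> {}" "set [3, 4, 8, 7] \<inter> S \<noteq> {}"
      "set [4, 5, 1, 8] \<inter> S \<noteq> {}" "set [1, 2, 3, 4, 5] \<inter> S \<noteq> {}" "set [2, 3, 4, 5, 6] \<inter> S \<noteq> {}"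
      "set [3, 4, 5, 6, 7] \<inter> S \<noteq> {}" "set [4, 5, 6, 7, 8] \<inter> S \<noteq> {}" "set [5, 6, 7, 8, 1] \<inter> S \<noteq> {}"
      "set [6, 7, 8, 1, 2] \<inter> S \<noteq> {}" "set [7, 8, 1, 2, 3] \<inter> S \<noteq> {}" "set [8, 1, 2, 3, 4] \<inter> S \<noteq> {}"
      by (rule hit, rule wagner_cycles, simp)+
    then have "S \<noteq> {}" by blast
    moreover have "finite S" using S(1) by (auto simp: verts_wagner intro: finite_subset)
    ultimately have "card S = 1 \<or> card S = 2"
      using \<open>\<not> 3 \<le> card S\<close> card_0_eq[of S] by linarith
    \<comment> \<open>Allowing \<open>a = b\<close> includes singletons. Each of the resulting
      choices of \<open>a\<close> and \<open>b\<close> misses one of the twelve cycles.\<close>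
    then obtain a b where ab: "S = {a, b}"
      by (auto simp: card_1_singleton_iff card_2_iff)
    with S(1) have "a \<in> {1, 2, 3, 4, 5, 6, 7, 8}" "b \<in> {1, 2, 3, 4, 5, 6, 7, 8}"
      unfolding verts_wagner by blast+
    then show False
      by (elim insertE emptyE) (use hits in \<open>simp_all add: ab\<close>)
  qed
  then show ?thesis
    unfolding feedback_vertex_number_def using fin ne by (subst Min_ge_iff) auto
qed

theorem lemma12:
  shows "partially_DP_nice wagner \<and>
    partial_DP_chromatic_number 2 wagner \<ge> 6 \<and>
    (6 :: int) > int (card (verts wagner)) - int (feedback_vertex_number wagner)"
proof -
  have a1: "3 \<le> partial_DP_chromatic_number 1 wagner"
    by (rule partial_DP_geI[OF simple_graph_wagner _ one_fold_wagner]) simp_all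
  have a2: "6 \<le> partial_DP_chromatic_number 2 wagner"
    by (rule partial_DP_geI[OF simple_graph_wagner _ two_fold_wagner]) simp_all
  have a3: "8 \<le> partial_DP_chromatic_number 3 wagner"
    by (rule partial_DP_geI[OF simple_graph_wagner]) (use three_fold_wagner in fastforce)+
  \<comment> \<open>The required bounds are 8/3, 16/3 and 8, against 3, 6 and 8; and 8 minus the
    feedback vertex number is at most 5.\<close>
  have "{1..3::nat} = {1, 2, 3}" by auto
  then have "partially_DP_nice wagner"
    using a1 a2 a3 by (simp add: partially_DP_nice_def DP_chromatic_number_wagner card_wagner)
  with a2 card_wagner feedback_vertex_number_wagner show ?thesis by simp
qed

end
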